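(* Let $m$ be a positive integer. If $h\in\mathcal{C}(\mathbb{R}^m)$, then for each $\epsilon>0$ the ball $B_\epsilon(h)$ of radius $\epsilon$ around $h$ (with respect to the metric $D$) contains a map $f$ having no (even discontinuous) iterative square root on $\mathbb{R}^m$, i.e. such that there is no map $g:\mathbb{R}^m\to\mathbb{R}^m$, continuous or not, with $g\circ g=f$. In particular, $\mathcal{W}(2;\mathbb{R}^m)$ does not contain any ball of $\mathcal{C}(\mathbb{R}^m)$.
   Context: $\mathbb{R}^m$ carries the metric induced by $\|(x_1,\dots,x_m)\|_\infty=\max_i|x_i|$. $\mathcal{C}(\mathbb{R}^m)$ is the space of all continuous self-maps of $\mathbb{R}^m$ with the compact-open topology, metrized as follows. Fix a sequence $(M_j)_{j\in\mathbb{N}}$ ($\mathbb{N}=\{1,2,\dots\}$) of $m$-simplices of $\mathbb{R}^m$ (convex hulls of $m+1$ affinely independent points) such that $\mathbb{R}^m=\bigcup_{j=1}^\infty M_j$, every compact subset of $\mathbb{R}^m$ is contained in the union of finitely many of the $M_j$, and for all $i,j$ either $M_i\cap M_j=\emptyset$ or $M_i\cap M_j$ is a common face of both $M_i$ and $M_j$. For $f,g\in\mathcal{C}(\mathbb{R}^m)$ put $\rho_j(f,g)=\sup\{\|f(x)-g(x)\|_\infty: x\in M_j\}$, $\mu_j(f,g)=\min\{2^{-j},\rho_j(f,g)\}$ and $D(f,g)=\sum_{j=1}^\infty\mu_j(f,g)$. Then $D$ is a metric inducing the compact-open topology on $\mathcal{C}(\mathbb{R}^m)$, and $B_\epsilon(h)=\{f\in\mathcal{C}(\mathbb{R}^m):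 D(f,h)<\epsilon\}$. $\mathcal{W}(2;\mathbb{R}^m)=\{g\circ g: g\in\mathcal{C}(\mathbb{R}^m)\}$. *)

theory Defs
  imports "HOL-Analysis.Analysis"
begin

text \<open>
  \<open>real ^ 'm\<close> with \<open>m = CARD('m) \<ge> 1\<close> plays the role of \<open>\<real>\<^sup>m\<close>; the maximum norm is the
  library's \<^const>\<open>infnorm\<close>. It induces the same topology as the Euclidean norm, so
  \<^const>\<open>continuous_on\<close> is the right notion of continuity.
  Sequences are indexed by \<open>{1, 2, \<dots>}\<close>; the value of \<open>M\<close> at \<open>0\<close> is never used.
\<close>

definition simplex_decomposition :: "(nat \<Rightarrow> (real ^ 'm) set) \<Rightarrow> bool" where
  "simplex_decomposition M \<longleftrightarrow>
     (\<forall>j\<ge>1. int CARD('m) simplex M j) \<and>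
     (\<Union>j\<in>{1..}. M j) = UNIV \<and>
     (\<forall>K. compact K \<longrightarrow> (\<exists>J. finite J \<and> J \<subseteq> {1..} \<and> K \<subseteq> (\<Union>j\<in>J. M j))) \<and>
     (\<forall>i\<ge>1. \<forall>j\<ge>1. M i \<inter> M j = {} \<or>
        ((M i \<inter> M j) face_of M i \<and> (M i \<inter> M j) face_of M j))"

definition cont_maps :: "(real ^ 'm \<Rightarrow> real ^ 'm) set" where
  "cont_maps = {f. continuous_on UNIV f}"

definition rho :: "(nat \<Rightarrow> (real ^ 'm) set) \<Rightarrow> nat \<Rightarrow>
    (real ^ 'm \<Rightarrow> real ^ 'm) \<Rightarrow> (real ^ 'm \<Rightarrow> real ^ 'm) \<Rightarrow> real" where
  "rho M j f g = (SUP x\<in>M j. infnorm (f x - g x))"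

definition mu :: "(nat \<Rightarrow> (real ^ 'm) set) \<Rightarrow> nat \<Rightarrow>
    (real ^ 'm \<Rightarrow> real ^ 'm) \<Rightarrow> (real ^ 'm \<Rightarrow> real ^ 'm) \<Rightarrow> real" where
  "mu M j f g = min (1 / 2 ^ j) (rho M j f g)"

definition D :: "(nat \<Rightarrow> (real ^ 'm) set) \<Rightarrow>
    (real ^ 'm \<Rightarrow> real ^ 'm) \<Rightarrow> (real ^ 'm \<Rightarrow> real ^ 'm) \<Rightarrow> real" where
  "D M f g = (\<Sum>j. mu M (Suc j) f g)"

definition D_ball :: "(nat \<Rightarrow> (real ^ 'm) set) \<Rightarrow>
    (real ^ 'm \<Rightarrow> real ^ 'm) \<Rightarrow> real \<Rightarrow> (real ^ 'm \<Rightarrow> real ^ 'm) set" where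
  "D_ball M h \<epsilon> = {f \<in> cont_maps. D M f h < \<epsilon>}"

definition W2 :: "(real ^ 'm \<Rightarrow> real ^ 'm) set" where
  "W2 = {g \<circ> g | g. g \<in> cont_maps}"

end

theory Submission
  imports Defs
begin

text \<open>
  The metric \<open>D\<close> only sees finitely many simplices up to a small error, so \<open>h\<close> may be changed
  arbitrarily outside a compact set \<open>K\<close>. Fix a coordinate \<open>i\<close>, write \<open>e\<close> for the unit vector
  \<open>axis i 1\<close>, and let \<open>R > 0\<close> bound \<open>\<bar>x $ i\<bar>\<close> and \<open>\<bar>h x $ i\<bar>\<close> on \<open>K\<close>. Take \<open>f = h\<close> on \<open>K\<close>,
  \<open>f x = 7 R e - 2 x\<close> for \<open>x $ i \<ge> 3 R\<close>, \<open>f x = - 7 R e - 2 x\<close> for \<open>x $ i \<le> - 3 R\<close>, and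
  \<open>\<bar>f x $ i\<bar> \<le> R\<close> in the slab between. Then \<open>7 R e\<close> and \<open>- 7 R e\<close> form a 2-cycle of \<open>f\<close> with
  no further preimages, whereas every other 2-cycle lies in the slab \<open>\<bar>x $ i\<bar> \<le> R\<close> and hence
  has preimages of second order passing through \<open>3 R \<le> x $ i\<close>. A square root \<open>g\<close> of \<open>f\<close>
  would interlace the first cycle with one of the others into a 4-cycle; since \<open>g\<close> commutes with
  \<open>f\<close>, it maps the preimages of the second cycle to preimages of the first, which are too few.
\<close>

text \<open>A square root would carry this cycle to another one with the same number of preimages at
  every depth, but \<open>a\<close> and \<open>b\<close> have none outside their cycle.\<close>

lemma isolated_two_cycle_no_square_root:
  assumes ab: "f a = b" "f b = a" "a \<noteq> b"
    and pre_a: "\<And>x. f x = a \<Longrightarrow> x = b"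
    and pre_b: "\<And>x. f x = b \<Longrightarrow> x = a"
    and other: "\<And>c d. \<lbrakk>f c = d; f d = c; c \<noteq> d; c \<noteq> a; c \<noteq> b\<rbrakk> \<Longrightarrow> \<exists>y. f (f y) = c \<and> f y \<noteq> d"
  shows "\<not> (\<exists>g. g \<circ> g = f)"
proof
  assume "\<exists>g. g \<circ> g = f"
  then obtain g where "g \<circ> g = f" by blast
  then have gg: "g (g x) = f x" for x
    by (auto simp: fun_eq_iff)
  then have comm: "f (g x) = g (f x)" for x
    by metis
  \<comment> \<open>If \<open>g a = a\<close>, then \<open>f a = a\<close>; if
    \<open>g a = b\<close>, then \<open>g b = f a = b\<close>, so \<open>f b = b\<close>.\<close>
  have "f (g a) = g b" "f (g b) = g a" "g a \<noteq> g b" "g a \<noteq> a" "g a \<noteq> b"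
    using ab gg comm by metis+
  from other[OF this] obtain y where y: "f (f y) = g a" "f y \<noteq> g b"
    by blast
  \<comment> \<open>\<open>f (g (f y)) = g (f (f y)) = g (g a) = f a = b\<close>. Two unique
    preimages lead back to \<open>g y = b\<close>, so \<open>f y = g b\<close>.\<close>
  have "f (g (f y)) = b"
    using y(1) ab gg comm by simp
  then have "f (g y) = a"
    using pre_b comm by metis
  then have "g y = b"
    by (rule pre_a)
  then show False
    using y(2) gg by metis
qed

lemma two_cycle_expansion_no_square_root:
  fixes f :: "real ^ 'm \<Rightarrow> real ^ 'm" and i :: 'm
  assumes R: "R > 0"
    and right: "\<And>x. x $ i \<ge> 3 * R \<Longrightarrow> f x = axis i (7 * R) - 2 *\<^sub>R x"
    and left: "\<And>x. x $ i \<le> - 3 * R \<Longrightarrow> f x = - axis i (7 * R) - 2 *\<^sub>R x"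
    and mid: "\<And>x. \<bar>x $ i\<bar> \<le> 3 * R \<Longrightarrow> \<bar>f x $ i\<bar> \<le> R"
  shows "\<not> (\<exists>g. g \<circ> g = f)"
proof -
  define p :: "real ^ 'm" where "p = axis i (7 * R)"
  have p_i: "p $ i = 7 * R"
    by (simp add: p_def)
  have right': "f x = p - 2 *\<^sub>R x" if "x $ i \<ge> 3 * R" for x
    using right[OF that] by (simp add: p_def)
  have left': "f x = - p - 2 *\<^sub>R x" if "x $ i \<le> - 3 * R" for x
    using left[OF that] by (simp add: p_def)
  have half: "x = (1 / 2) *\<^sub>R (a - b)" if "a - 2 *\<^sub>R x = b" for a b x :: "real ^ 'm"
    using that by auto
  have trichotomy: "x $ i \<ge> 3 * R \<or> x $ i \<le> - 3 * R \<or> \<bar>x $ i\<bar> \<le> 3 * R" for x :: "real ^ 'm"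
    by linarith
  show ?thesis
  proof (rule isolated_two_cycle_no_square_root[of f p "- p"])
    have "f p = p - 2 *\<^sub>R p"
      by (rule right') (use R p_i in simp)
    then show "f p = - p"
      by (simp only: scaleR_2 diff_add_eq_diff_diff_swap diff_self diff_0)
    have "f (- p) = - p - 2 *\<^sub>R (- p)"
      by (rule left') (use R p_i in simp)
    then show "f (- p) = p"
      by (simp only: scaleR_2 diff_add_eq_diff_diff_swap diff_self diff_0 minus_minus)
    show "p \<noteq> - p"
    proof
      assume "p = - p"
      then have "p $ i = (- p) $ i" by (rule arg_cong[where f = "\<lambda>v. v $ i"])
      then show False using R p_i by simp
    qed
  next
    fix x assume fx: "f x = p"
    \<comment> \<open>The right branch reaches \<open>p\<close> only from 0, the left one only from
      \<open>- p\<close>, and images of the slab have too small an \<open>i\<close>-th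
      coordinate.\<close>
    consider "x $ i \<ge> 3 * R" | "x $ i \<le> - 3 * R" | "\<bar>x $ i\<bar> \<le> 3 * R"
      using trichotomy by blast
    then show "x = - p"
    proof cases
      case 1
      with half[of p x p] fx right' have "x = 0" by simp
      with 1 R show ?thesis by simp
    next
      case 2
      have "- p - 2 *\<^sub>R x = p" using fx left'[OF 2] by metis
      from half[OF this] show ?thesis by (simp add: vec_eq_iff)
    next
      case 3
      with fx mid R p_i show ?thesis by fastforce
    qed
  next
    fix x assume fx: "f x = - p"
    consider "x $ i \<ge> 3 * R" | "x $ i \<le> - 3 * R" | "\<bar>x $ i\<bar> \<le> 3 * R"
      using trichotomy by blast
    then show "x = p"
    proof cases
      case 1
      have "p - 2 *\<^sub>R x = - p" using fx right'[OF 1] by metis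
      from half[OF this] show ?thesis by (simp add: vec_eq_iff)
    next
      case 2
      with half[of "- p" x "- p"] fx left' have "x = 0" by simp
      with 2 R show ?thesis by simp
    next
      case 3
      with mid[of x] fx R p_i show ?thesis by simp
    qed
  next
    fix c d assume cd: "f c = d" "f d = c" "c \<noteq> d" "c \<noteq> p" "c \<noteq> - p"
    \<comment> \<open>One point in the wide slab suffices: going once around the cycle puts both
      points into the narrow one.\<close>
    have inner: "\<bar>v $ i\<bar> \<le> R \<and> \<bar>u $ i\<bar> \<le> R" if "f u = v" "f v = u" "\<bar>u $ i\<bar> \<le> 3 * R" for u v
      using mid[of u] mid[of v] that R by auto
    \<comment> \<open>On one side, subtracting the two equations gives
      \<open>c - d = 2 (c - d)\<close>; on opposite sides, they force \<open>c\<close> to be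
      \<open>p\<close> or \<open>- p\<close>.\<close>
    have "\<bar>c $ i\<bar> \<le> 3 * R \<or> \<bar>d $ i\<bar> \<le> 3 * R"
    proof (rule ccontr)
      assume "\<not> ?thesis"
      then consider "c $ i \<ge> 3 * R" "d $ i \<ge> 3 * R" | "c $ i \<le> - 3 * R" "d $ i \<le> - 3 * R"
        | "c $ i \<ge> 3 * R" "d $ i \<le> - 3 * R" | "c $ i \<le> - 3 * R" "d $ i \<ge> 3 * R"
        by linarith
      then show False
      proof cases
        case 1
        have d: "d = p - 2 *\<^sub>R c" and c: "c = p - 2 *\<^sub>R d"
          using cd right'[OF 1(1)] right'[OF 1(2)] by auto
        have "c - d = 2 *\<^sub>R (c - d)"
          by (rule trans[OF arg_cong2[OF c d, of minus]]) (simp add: vec_eq_iff)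
        with cd show False by (simp add: scaleR_2)
      next
        case 2
        have d: "d = - p - 2 *\<^sub>R c" and c: "c = - p - 2 *\<^sub>R d"
          using cd left'[OF 2(1)] left'[OF 2(2)] by auto
        have "c - d = 2 *\<^sub>R (c - d)"
          by (rule trans[OF arg_cong2[OF c d, of minus]]) (simp add: vec_eq_iff)
        with cd show False by (simp add: scaleR_2)
      next
        case 3
        have d: "d = p - 2 *\<^sub>R c" and c: "c = - p - 2 *\<^sub>R d"
          using cd right'[OF 3(1)] left'[OF 3(2)] by auto
        have "c $ k = p $ k" for k
          using arg_cong[OF c, of "\<lambda>v. v $ k"] arg_cong[OF d, of "\<lambda>v. v $ k"] by simp
        with cd show False by (simp add: vec_eq_iff)
      next
        case 4
        have d: "d = - p - 2 *\<^sub>R c" and c: "c = p - 2 *\<^sub>R d"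
          using cd left'[OF 4(1)] right'[OF 4(2)] by auto
        have "c $ k = (- p) $ k" for k
          using arg_cong[OF c, of "\<lambda>v. v $ k"] arg_cong[OF d, of "\<lambda>v. v $ k"] by simp
        with cd show False by (simp add: vec_eq_iff)
      qed
    qed
    with inner[of c d] inner[of d c] cd have bd: "\<bar>c $ i\<bar> \<le> R" "\<bar>d $ i\<bar> \<le> R"
      by auto
    \<comment> \<open>Invert the right branch at \<open>c\<close>, then the left one at
      \<open>x\<close>. The constant 7 makes \<open>x $ i\<close> at least
      \<open>(7 R - R) / 2 = 3 R\<close>, hence \<open>y $ i\<close> at most
      \<open>- 5 R\<close>.\<close>
    define x where "x = (1 / 2) *\<^sub>R (p - c)"
    define y where "y = - (1 / 2) *\<^sub>R (p + x)"
    have x_i: "x $ i \<ge> 3 * R"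
      using bd p_i by (simp add: x_def)
    have fx: "f x = c"
      using right'[OF x_i] by (simp add: x_def)
    have "y $ i \<le> - 3 * R"
      using x_i p_i R by (simp add: y_def)
    from left'[OF this] have fy: "f y = x"
      by (simp add: y_def)
    have "x \<noteq> d"
      using x_i bd R by auto
    with fx fy show "\<exists>y. f (f y) = c \<and> f y \<noteq> d"
      by blast
  qed
qed

text \<open>A cutoff in the \<open>i\<close>-th coordinate blends \<open>h\<close> into the two
  affine branches. In the slab both ingredients have \<open>i\<close>-th coordinate in
  \<open>[-R, R]\<close>, and convexity keeps the blend there.\<close>

lemma no_square_root_extension:
  fixes h :: "real ^ 'm \<Rightarrow> real ^ 'm"
  assumes h: "continuous_on UNIV h" and K: "compact K"
  obtains f where "continuous_on UNIV f" "\<And>x. x \<in> K \<Longrightarrow> f x = h x" "\<not> (\<exists>g. g \<circ> g = f)"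
proof -
  fix i :: 'm
  have "bounded (K \<union> h ` K)"
    using K h by (auto intro!: compact_imp_bounded compact_continuous_image
        intro: continuous_on_subset)
  then obtain R where R: "R > 0" and bound: "\<And>x. x \<in> K \<union> h ` K \<Longrightarrow> norm x \<le> R"
    by (auto simp: bounded_pos)
  have K_i: "\<bar>x $ i\<bar> \<le> R" "\<bar>h x $ i\<bar> \<le> R" if "x \<in> K" for x
    using that bound component_le_norm_cart order_trans by (metis UnCI imageI)+
  define clamp where "clamp r t = max (- r) (min r t)" for r t :: real
  have clamp_bound: "\<bar>clamp r t\<bar> \<le> r" if "r \<ge> 0" for r t
    using that by (auto simp: clamp_def)
  have clamp_id: "clamp r t = t" if "\<bar>t\<bar> \<le> r" for r t
    using that by (auto simp: clamp_def)
  \<comment> \<open>1 for \<open>\<bar>t\<bar> \<le> R\<close> and 0 for \<open>\<bar>t\<bar> \<ge> 3 R\<close>\<close>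
  define s where "s t = max 0 (min 1 ((3 * R - \<bar>t\<bar>) / (2 * R)))" for t
  \<comment> \<open>Truncating the \<open>i\<close>-th component bounds it by \<open>R\<close>
    everywhere and leaves \<open>h\<close> unchanged on \<open>K\<close>.\<close>
  define h' where "h' x = h x + axis i (clamp R (h x $ i) - h x $ i)" for x
  \<comment> \<open>the \<open>i\<close>-th component is \<open>x $ i / 3\<close> where \<open>\<bar>x $ i\<bar> \<le> 3 R\<close>\<close>
  define q where "q x = axis i (7 / 3 * clamp (3 * R) (x $ i)) - 2 *\<^sub>R x" for x
  define f where "f x = s (x $ i) *\<^sub>R h' x + (1 - s (x $ i)) *\<^sub>R q x" for x
  have axis_scaleR: "axis i t = t *\<^sub>R axis i (1 :: real)" for t
    by (simp add: vec_eq_iff axis_def)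
  show thesis
  proof (rule that)
    show "continuous_on UNIV f"
      unfolding f_def h'_def q_def s_def clamp_def
      by (subst (1 2) axis_scaleR) (use R in \<open>intro continuous_intros h; simp\<close>)
  next
    fix x assume x: "x \<in> K"
    have "s (x $ i) = 1"
      using K_i(1)[OF x] R by (simp add: s_def min_def max_def field_simps)
    then show "f x = h x"
      using K_i(2)[OF x] by (simp add: f_def h'_def clamp_id vec_eq_iff axis_def)
  next
    have s0: "s t = 0" if "\<bar>t\<bar> \<ge> 3 * R" for t
      using that R by (simp add: s_def max_def min_def divide_simps)
    show "\<not> (\<exists>g. g \<circ> g = f)"
    proof (rule two_cycle_expansion_no_square_root[OF R])
      fix x :: "real ^ 'm" assume x: "x $ i \<ge> 3 * R"
      then have "clamp (3 * R) (x $ i) = 3 * R" using R by (simp add: clamp_def)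
      with x s0[of "x $ i"] show "f x = axis i (7 * R) - 2 *\<^sub>R x"
        by (simp add: f_def q_def)
    next
      fix x :: "real ^ 'm" assume x: "x $ i \<le> - 3 * R"
      then have "clamp (3 * R) (x $ i) = - 3 * R" using R by (simp add: clamp_def)
      with x s0[of "x $ i"] show "f x = - axis i (7 * R) - 2 *\<^sub>R x"
        by (simp add: f_def q_def vec_eq_iff axis_def)
    next
      fix x :: "real ^ 'm" assume x: "\<bar>x $ i\<bar> \<le> 3 * R"
      have h'_i: "\<bar>h' x $ i\<bar> \<le> R"
        using R clamp_bound by (simp add: h'_def)
      have q_i: "\<bar>q x $ i\<bar> \<le> R"
        using x by (simp add: q_def clamp_id)
      have "0 \<le> s (x $ i)" "s (x $ i) \<le> 1"
        by (auto simp: s_def)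
      with h'_i q_i have "s (x $ i) *\<^sub>R (h' x $ i) + (1 - s (x $ i)) *\<^sub>R (q x $ i) \<in> {- R..R}"
        by (intro convexD[OF convex_real_interval(5)]) auto
      then show "\<bar>f x $ i\<bar> \<le> R"
        by (auto simp: f_def)
    qed
  qed
qed

text \<open>Compactness bounds the set under \<open>SUP\<close>, whose value would otherwise be
  unspecified.\<close>

lemma rho_nonneg:
  assumes "continuous_on UNIV f" "continuous_on UNIV h" "compact (M j)" "M j \<noteq> {}"
  shows "0 \<le> rho M j f h"
proof -
  have "continuous_on (M j) (\<lambda>x. infnorm (f x - h x))"
    using assms by (intro continuous_on_infnorm continuous_intros) (auto intro: continuous_on_subset)
  then have "bdd_above ((\<lambda>x. infnorm (f x - h x)) ` M j)"
    using assms by (intro bounded_imp_bdd_above compact_imp_bounded compact_continuous_image)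
  moreover obtain x where "x \<in> M j"
    using assms by blast
  ultimately show ?thesis
    unfolding rho_def by (intro cSUP_upper2[where x = x]) (auto simp: infnorm_pos_le)
qed

text \<open>The first \<open>N\<close> terms contribute at most 0, and the caps
  \<open>1 / 2 ^ j\<close> with \<open>j > N\<close> add up to \<open>(1 / 2) ^ N\<close>.\<close>

lemma D_le_of_agree:
  assumes f: "continuous_on UNIV f" and h: "continuous_on UNIV h"
    and M: "\<And>j. j \<ge> 1 \<Longrightarrow> compact (M j) \<and> M j \<noteq> {}"
    and agree: "\<And>j x. \<lbrakk>1 \<le> j; j \<le> N; x \<in> M j\<rbrakk> \<Longrightarrow> f x = h x"
  shows "D M f h \<le> (1 / 2) ^ N"
proof -
  \<comment> \<open>Index \<open>j\<close> of the series belongs to \<open>M (Suc j)\<close>, so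
    \<open>j < N\<close> covers the simplices 1 to \<open>N\<close>.\<close>
  let ?b = "\<lambda>j. if j < N then 0 else (1 / 2 :: real) ^ Suc j"
  have pos: "0 \<le> mu M (Suc j) f h" for j
    using rho_nonneg[OF f h] M by (simp add: mu_def)
  have le: "mu M (Suc j) f h \<le> ?b j" for j
  proof (cases "j < N")
    case True
    have "rho M (Suc j) f h = (SUP x\<in>M (Suc j). 0)"
      unfolding rho_def using agree[of "Suc j"] True by (intro SUP_cong) (auto simp: infnorm_0)
    also have "\<dots> = 0"
      using M by simp
    finally show ?thesis
      using True by (simp add: mu_def)
  next
    case False
    then show ?thesis
      by (simp add: mu_def power_one_over)
  qed
  have "(\<lambda>j. (1 / 2) ^ N * (1 / 2 :: real) ^ Suc j) sums ((1 / 2) ^ N * 1)"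
    by (intro sums_mult power_half_series)
  then have "(\<lambda>j. ?b (j + N)) sums ((1 / 2) ^ N)"
    by (simp add: power_add mult_ac)
  then have b: "?b sums ((1 / 2) ^ N)"
    by (subst (asm) sums_iff_shift) simp
  have "summable (\<lambda>j. mu M (Suc j) f h)"
    using pos le by (intro summable_comparison_test'[OF sums_summable[OF b], of 0]) auto
  then have "D M f h \<le> suminf ?b"
    unfolding D_def using le sums_summable[OF b] by (intro suminf_le) auto
  with b show ?thesis
    by (simp add: sums_iff)
qed

theorem theorem4p3:
  fixes M :: "nat \<Rightarrow> (real ^ 'm) set"
  assumes "simplex_decomposition M"
  shows "(\<forall>h\<in>cont_maps. \<forall>\<epsilon>>0. \<exists>f\<in>D_ball M h \<epsilon>. \<not> (\<exists>g :: real ^ 'm \<Rightarrow> real ^ 'm. g \<circ> g = f))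
    \<and> (\<forall>h\<in>cont_maps. \<forall>\<epsilon>>0. \<not> D_ball M h \<epsilon> \<subseteq> W2)"
proof -
  have M: "compact (M j) \<and> M j \<noteq> {}" if "j \<ge> 1" for j
  proof -
    have "int CARD('m) simplex M j"
      using assms that by (simp add: simplex_decomposition_def)
    then show ?thesis
      \<comment> \<open>The empty set is a simplex only in dimension -1.\<close>
      using simplex_empty[of "int CARD('m)"] by (auto simp: compact_simplex)
  qed
  have ex: "\<exists>f\<in>D_ball M h \<epsilon>. \<not> (\<exists>g. g \<circ> g = f)"
    if h: "h \<in> cont_maps" and \<epsilon>: "\<epsilon> > 0" for h :: "real ^ 'm \<Rightarrow> real ^ 'm" and \<epsilon> :: real
  proof -
    obtain N where N: "(1 / 2) ^ N < \<epsilon>"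
      using real_arch_pow_inv[OF \<epsilon>, of "1 / 2"] by auto
    have "compact (\<Union>j\<in>{1..N}. M j)"
      using M by (intro compact_UN) auto
    then obtain f where f: "continuous_on UNIV f" "\<And>x. x \<in> (\<Union>j\<in>{1..N}. M j) \<Longrightarrow> f x = h x"
        "\<not> (\<exists>g. g \<circ> g = f)"
      using no_square_root_extension h by (metis cont_maps_def mem_Collect_eq)
    have "D M f h \<le> (1 / 2) ^ N"
    proof (rule D_le_of_agree)
      show "f x = h x" if "1 \<le> j" "j \<le> N" "x \<in> M j" for j x
        using that by (intro f(2)) auto
    qed (use f(1) h M in \<open>auto simp: cont_maps_def\<close>)
    with N f show ?thesis
      by (auto simp: D_ball_def cont_maps_def)
  qed
  have "\<not> D_ball M h \<epsilon> \<subseteq> W2" if "h \<in> cont_maps" "\<epsilon> > 0" for h :: "real ^ 'm \<Rightarrow> real ^ 'm" and \<epsilon> :: real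
    using ex[OF that] unfolding W2_def by blast
  with ex show ?thesis
    by blast
qed

end
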